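(* Let $0<\beta<1$. Then, for all $q(\cdot)\in\mathscr{B}(\mathbb{R}^n)$, $\dot{\Lambda}_{\beta}^{+}(\mathbb{R}^n)=\dot{\Lambda}_{\beta,q(\cdot)}^{\ast}(\mathbb{R}^n)$. Furthermore, for each such $q(\cdot)$ there exist positive constants $C_1$ and $C_2$ such that, for all $b\in\dot{\Lambda}_{\beta}^{+}(\mathbb{R}^n)$, $$C_1\|b\|_{\dot{\Lambda}_{\beta}}\le\|b\|_{\dot{\Lambda}_{\beta,q(\cdot)}^{\ast}}\le C_2\|b\|_{\dot{\Lambda}_{\beta}}.$$
   Context: Functions are real-valued and identified when equal almost everywhere; in particular $b\in\dot{\Lambda}_\beta(\mathbb{R}^n)$ means that $b$ agrees a.e. with a function satisfying the condition below, and $b\ge0$ is understood a.e. A cube $Q\subset\mathbb{R}^n$ always has sides parallel to the coordinate axes; $|Q|$ is its Lebesgue measure and $\chi_Q$ its characteristic function. Lipschitz space: for $0<\beta<1$, $b\in\dot{\Lambda}_{\beta}(\mathbb{R}^n)$ if there is a constant $C$ with $|b(x)-b(y)|\le C|x-y|^{\beta}$ for all $x,y\in\mathbb{R}^n$; the smallest such $C$ is denoted $\|b\|_{\dot{\Lambda}_{\beta}}$. $\dot{\Lambda}_{\beta}^{+}(\mathbb{R}^n)=\{b: 0\le b\in\dot{\Lambda}_{\beta}(\mathbb{R}^n)\}$ is the set of nonnegative Lipschitz functions. Hardy-Littlewood maximal function: $M(f)(x)=\sup_{Q\ni x}\frac1{|Q|}\int_Q|f(y)|\,dy$, the supremum over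 all cubes $Q\subset\mathbb{R}^n$ containing $x$. For a fixed cube $Q_0$, $M_{Q_0}(f)(x)=\sup\frac1{|Q|}\int_Q|f(y)|\,dy$, the supremum over all cubes $Q$ with $x\in Q\subseteq Q_0$. Variable exponent Lebesgue space: for measurable $p(\cdot):\mathbb{R}^n\to[1,\infty)$, $L^{p(\cdot)}(\mathbb{R}^n)$ is the set of measurable $f$ with $\int_{\mathbb{R}^n}(|f(x)|/\lambda)^{p(x)}dx<\infty$ for some $\lambda>0$, with norm $\|f\|_{L^{p(\cdot)}(\mathbb{R}^n)}=\inf\{\lambda>0:\int_{\mathbb{R}^n}(|f(x)|/\lambda)^{p(x)}dx\le1\}$ (equal to $\infty$ if $f\notin L^{p(\cdot)}(\mathbb{R}^n)$). $\mathscr{P}(\mathbb{R}^n)$ is the set of measurable $p(\cdot):\mathbb{R}^n\to[1,\infty)$ with $1<\operatorname{ess\,inf}_{x}p(x)$ and $\operatorname{ess\,sup}_{x}p(x)<\infty$. $\mathscr{B}(\mathbb{R}^n)$ is the set of $p(\cdot)\in\mathscr{P}(\mathbb{R}^n)$ such that $M$ is bounded on $L^{p(\cdot)}(\mathbb{R}^n)$. For $0<\beta<1$ and $q(\cdot)\in\mathscr{B}(\mathbb{R}^n)$, $\dot{\Lambda}_{\beta,q(\cdot)}^{\ast}(\mathbb{R}^n)$ is the set of $b\in L^1_{\rm loc}(\mathbb{R}^n)$ with $$\|b\|_{\dot{\Lambda}_{\beta,q(\cdot)}^{\ast}}=\sup_{Q}\frac1{|Q|^{\beta/n}}\frac{\|(b-M_Q(b))\chi_Q\|_{L^{q(\cdot)}(\mathbb{R}^n)}}{\|\chi_Q\|_{L^{q(\cdot)}(\mathbb{R}^n)}}<\infty,$$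 the supremum over all cubes $Q\subset\mathbb{R}^n$. *)

theory Defs
  imports "HOL-Analysis.Analysis" "HOL-Probability.Essential_Supremum"
begin

(* Functions on R^n are total functions on real ^ 'n that are Lebesgue measurable; identification
   almost everywhere is built into the predicates below. *)

(* Cubes are closed and nondegenerate, with sides parallel to the axes. *)
definition cubes :: "(real ^ 'n::finite) set set" where
  "cubes = {cbox a (\<chi> i. a $ i + l) |a l. 0 < l}"

definition cube_avg :: "(real ^ 'n::finite \<Rightarrow> real) \<Rightarrow> (real ^ 'n) set \<Rightarrow> ennreal" where
  "cube_avg f Q = (\<integral>\<^sup>+ y\<in>Q. ennreal \<bar>f y\<bar> \<partial>lebesgue) / emeasure lebesgue Q"

definition HL_maximal :: "(real ^ 'n::finite \<Rightarrow> real) \<Rightarrow> real ^ 'n \<Rightarrow> ennreal" where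
  "HL_maximal f x = (SUP Q\<in>{Q \<in> cubes. x \<in> Q}. cube_avg f Q)"

definition local_maximal ::
    "(real ^ 'n::finite) set \<Rightarrow> (real ^ 'n \<Rightarrow> real) \<Rightarrow> real ^ 'n \<Rightarrow> ennreal" where
  "local_maximal Q\<^sub>0 f x = (SUP Q\<in>{Q \<in> cubes. x \<in> Q \<and> Q \<subseteq> Q\<^sub>0}. cube_avg f Q)"

(* The power t^p on [0, \<infinity>], for exponents p > 0. *)
definition ennpowr :: "ennreal \<Rightarrow> real \<Rightarrow> ennreal" where
  "ennpowr t p = (if t = \<infinity> then \<infinity> else ennreal (enn2real t powr p))"

(* Extended-real-valued functions are admitted because maximal functions may be infinite. *)
definition var_modular :: "(real ^ 'n::finite \<Rightarrow> real) \<Rightarrow> (real ^ 'n \<Rightarrow> ereal) \<Rightarrow> real \<Rightarrow> ennreal" where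
  "var_modular p f s = (\<integral>\<^sup>+ x. ennpowr (e2ennreal \<bar>f x\<bar> / ennreal s) (p x) \<partial>lebesgue)"

(* The infimum is taken in [0, \<infinity>]; the infimum of the empty set is \<infinity>. *)
definition var_norm :: "(real ^ 'n::finite \<Rightarrow> real) \<Rightarrow> (real ^ 'n \<Rightarrow> ereal) \<Rightarrow> ennreal" where
  "var_norm p f = (INF s\<in>{s::real. 0 < s \<and> var_modular p f s \<le> 1}. ennreal s)"

definition var_Lp :: "(real ^ 'n::finite \<Rightarrow> real) \<Rightarrow> (real ^ 'n \<Rightarrow> real) set" where
  "var_Lp p = {f \<in> borel_measurable lebesgue. \<exists>s>0. var_modular p (\<lambda>x. ereal (f x)) s < \<infinity>}"

(* Dual to the library's esssup. *)
definition ess_inf :: "'a measure \<Rightarrow> ('a \<Rightarrow> ereal) \<Rightarrow> ereal" where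
  "ess_inf M f = - esssup M (\<lambda>x. - f x)"

definition exponents_P :: "(real ^ 'n::finite \<Rightarrow> real) set" where
  "exponents_P = {p \<in> borel_measurable lebesgue. (\<forall>x. 1 \<le> p x) \<and>
     1 < ess_inf lebesgue (\<lambda>x. ereal (p x)) \<and> esssup lebesgue (\<lambda>x. ereal (p x)) < \<infinity>}"

definition exponents_B :: "(real ^ 'n::finite \<Rightarrow> real) set" where
  "exponents_B = {p \<in> exponents_P. \<exists>C::real. \<forall>f\<in>var_Lp p.
     var_norm p (\<lambda>x. enn2ereal (HL_maximal f x)) \<le> ennreal C * var_norm p (\<lambda>x. ereal (f x))}"

definition holder_const :: "real \<Rightarrow> (real ^ 'n::finite \<Rightarrow> real) \<Rightarrow> real \<Rightarrow> bool" where
  "holder_const \<beta> g C \<longleftrightarrow> 0 \<le> C \<and> (\<forall>x y. \<bar>g x - g y\<bar> \<le> C * norm (x - y) powr \<beta>)"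

definition Lip :: "real \<Rightarrow> (real ^ 'n::finite \<Rightarrow> real) set" where
  "Lip \<beta> = {b \<in> borel_measurable lebesgue.
     \<exists>g. (AE x in lebesgue. b x = g x) \<and> (\<exists>C. holder_const \<beta> g C)}"

(* The continuous representative g of b is unique, so this is the smallest constant for g. *)
definition Lip_norm :: "real \<Rightarrow> (real ^ 'n::finite \<Rightarrow> real) \<Rightarrow> ennreal" where
  "Lip_norm \<beta> b =
     (INF C\<in>{C. \<exists>g. (AE x in lebesgue. b x = g x) \<and> holder_const \<beta> g C}. ennreal C)"

definition Lip_plus :: "real \<Rightarrow> (real ^ 'n::finite \<Rightarrow> real) set" where
  "Lip_plus \<beta> = {b \<in> Lip \<beta>. AE x in lebesgue. 0 \<le> b x}"

definition L1_loc :: "(real ^ 'n::finite \<Rightarrow> real) set" where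
  "L1_loc = {b \<in> borel_measurable lebesgue. \<forall>K. compact K \<longrightarrow> set_integrable lebesgue K b}"

definition Lip_star_norm ::
    "real \<Rightarrow> (real ^ 'n::finite \<Rightarrow> real) \<Rightarrow> (real ^ 'n \<Rightarrow> real) \<Rightarrow> ennreal" where
  "Lip_star_norm \<beta> q b = (SUP Q\<in>cubes.
     1 / ennreal (measure lebesgue Q powr (\<beta> / real CARD('n))) *
     (var_norm q (\<lambda>x. (ereal (b x) - enn2ereal (local_maximal Q b x)) * indicator Q x) /
      var_norm q (indicator Q)))"

definition Lip_star :: "real \<Rightarrow> (real ^ 'n::finite \<Rightarrow> real) \<Rightarrow> (real ^ 'n \<Rightarrow> real) set" where
  "Lip_star \<beta> q = {b \<in> L1_loc. Lip_star_norm \<beta> q b < \<infinity>}"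

end

(* For b in the starred space, f = max(0, |b|_Q - b) on Q is dominated by |b - M_Q b|, and
   M f >= f_Q on Q. Hence boundedness of M on L^q gives f_Q <= C |Q|^(beta/n), with no duality
   argument. Since the mean of |b| - b over Q is at most f_Q, the negative part of b integrates to
   o(|Q|) over small cubes uniformly, and subdividing a cube shows b >= 0. Then |b|_Q = b_Q, the
   mean oscillation of b over Q is 2 f_Q, and Campanato's argument yields a Hoelder representative,
   namely the limit of averages over shrinking cubes with a common corner; it equals b almost
   everywhere by the same subdivision, without Lebesgue's differentiation theorem. Conversely, for b
   nonnegative and Hoelder continuous, every average over a subcube of Q differs from b(x) by
   at most the oscillation of b on Q. *)

theory Submission
  imports Defs
begin

section \<open>Axis-parallel cubes given by lower corner and side\<close>

definition cube :: "real ^ 'n::finite \<Rightarrow> real \<Rightarrow> (real ^ 'n) set" where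
  "cube a l = cbox a (\<chi> i. a $ i + l)"

lemma cubes_eq: "cubes = {cube a l |a l. 0 < l}"
  by (simp add: cubes_def cube_def)

lemma mem_cube: "x \<in> cube a l \<longleftrightarrow> (\<forall>i. a $ i \<le> x $ i \<and> x $ i \<le> a $ i + l)"
  by (simp add: cube_def mem_box_cart)

lemma cube_lmeasurable [simp]: "cube a l \<in> lmeasurable"
  by (simp add: cube_def)

lemma cube_sets [simp, measurable]: "cube a l \<in> sets lebesgue"
  using cube_lmeasurable fmeasurableD by blast

lemma measure_cube:
  fixes a :: "real ^ 'n::finite"
  assumes "0 \<le> l"
  shows "measure lebesgue (cube a l) = l ^ CARD('n)"
proof -
  have "cbox a (\<chi> i. a $ i + l) \<noteq> {}"
    using assms by (simp add: interval_ne_empty_cart)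
  then show ?thesis
    by (simp add: cube_def content_cbox_cart measure_completion)
qed

lemma emeasure_cube:
  fixes a :: "real ^ 'n::finite"
  assumes "0 \<le> l"
  shows "emeasure lebesgue (cube a l) = ennreal (l ^ CARD('n))"
  using measure_cube[OF assms] emeasure_eq_measure2[OF cube_lmeasurable] by metis

lemma cube_subset:
  assumes "\<And>i. c $ i \<le> a $ i" "\<And>i. a $ i + s \<le> c $ i + l"
  shows "cube a s \<subseteq> cube c l"
proof
  fix x assume "x \<in> cube a s"
  then have "a $ i \<le> x $ i" "x $ i \<le> a $ i + s" for i by (auto simp: mem_cube)
  with assms show "x \<in> cube c l" unfolding mem_cube by (meson order_trans)
qed

section \<open>Subdivision of cubes\<close>

text \<open>The set \<open>S\<close> lists the coordinates in which a half-size cube takes the upper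
  half. These 2^n closed cubes cover the original one; they share faces, which can only enlarge the
  sum.\<close>

lemma nn_integral_cube_halve:
  fixes h :: "real ^ 'n::finite \<Rightarrow> ennreal"
  assumes [measurable]: "h \<in> borel_measurable lebesgue"
  shows "(\<integral>\<^sup>+x\<in>cube a l. h x \<partial>lebesgue) \<le>
    (\<Sum>S\<in>(UNIV :: 'n set set). \<integral>\<^sup>+x\<in>cube (\<chi> i. a $ i + (if i \<in> S then l / 2 else 0)) (l / 2). h x \<partial>lebesgue)"
proof -
  let ?a = "\<lambda>S :: 'n set. \<chi> i. a $ i + (if i \<in> S then l / 2 else 0)"
  have "h x * indicator (cube a l) x \<le> (\<Sum>S\<in>UNIV. h x * indicator (cube (?a S) (l / 2)) x)" for x
  proof (cases "x \<in> cube a l")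
    case True
    \<comment> \<open>Coordinates on the middle hyperplane are assigned to the upper half.\<close>
    let ?S = "{i. a $ i + l / 2 \<le> x $ i}"
    have "x \<in> cube (?a ?S) (l / 2)"
      using True by (auto simp: mem_cube add.commute)
    then have "h x * indicator (cube a l) x \<le> h x * indicator (cube (?a ?S) (l / 2)) x"
      by (auto simp: indicator_def)
    also have "\<dots> \<le> (\<Sum>S\<in>UNIV. h x * indicator (cube (?a S) (l / 2)) x)"
      by (rule member_le_sum) auto
    finally show ?thesis .
  qed simp
  then have "(\<integral>\<^sup>+x\<in>cube a l. h x \<partial>lebesgue) \<le>
      (\<integral>\<^sup>+x. (\<Sum>S\<in>UNIV. h x * indicator (cube (?a S) (l / 2)) x) \<partial>lebesgue)"
    by (intro nn_integral_mono) auto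
  also have "\<dots> = (\<Sum>S\<in>UNIV. \<integral>\<^sup>+x\<in>cube (?a S) (l / 2). h x \<partial>lebesgue)"
    by (intro nn_integral_sum) measurable
  finally show ?thesis .
qed

text \<open>The volumes of the pieces add up again, but the extra factor
  \<open>l powr \<beta>\<close> shrinks: after k halvings the bounds sum to A l^n (l / 2^k)^\<beta>,
  which tends to 0. It is applied to \<open>\<bar>b x\<bar> - b x\<close> for the sign of
  \<open>b\<close> and to \<open>\<bar>b x - g x\<bar>\<close> for the representative.\<close>

lemma AE_zero_if_cube_integrals_small:
  fixes h :: "real ^ 'n::finite \<Rightarrow> ennreal"
  assumes [measurable]: "h \<in> borel_measurable lebesgue" and "0 < \<beta>" "0 \<le> A"
    and small: "\<And>a l. 0 < l \<Longrightarrow> (\<integral>\<^sup>+x\<in>cube a l. h x \<partial>lebesgue) \<le> ennreal (A * l ^ CARD('n) * l powr \<beta>)"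
  shows "AE x in lebesgue. h x = 0"
proof -
  have halved: "(\<integral>\<^sup>+x\<in>cube a l. h x \<partial>lebesgue) \<le> ennreal (A * l ^ CARD('n) * (l / 2 ^ k) powr \<beta>)"
    if "0 < l" for a l k
    using that
  proof (induction k arbitrary: a l)
    case 0
    then show ?case using small by simp
  next
    case (Suc k)
    let ?a = "\<lambda>S :: 'n set. \<chi> i. a $ i + (if i \<in> S then l / 2 else 0)"
    have "(\<integral>\<^sup>+x\<in>cube a l. h x \<partial>lebesgue) \<le> (\<Sum>S\<in>UNIV. \<integral>\<^sup>+x\<in>cube (?a S) (l / 2). h x \<partial>lebesgue)"
      by (rule nn_integral_cube_halve) simp
    also have "\<dots> \<le> (\<Sum>S\<in>(UNIV :: 'n set set). ennreal (A * (l / 2) ^ CARD('n) * (l / 2 / 2 ^ k) powr \<beta>))"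
      using Suc.prems by (intro sum_mono Suc.IH) auto
    also have "\<dots> = ennreal (\<Sum>S\<in>(UNIV :: 'n set set). A * (l / 2) ^ CARD('n) * (l / 2 / 2 ^ k) powr \<beta>)"
      using Suc.prems \<open>0 \<le> A\<close> by (subst sum_ennreal) auto
    \<comment> \<open>There are 2^n sets \<open>S\<close>, which cancels the factor (1/2)^n from the
      smaller volume.\<close>
    also have "\<dots> = ennreal (A * l ^ CARD('n) * (l / 2 ^ Suc k) powr \<beta>)"
      by (simp add: Pow_UNIV[symmetric] card_Pow power_divide del: Pow_UNIV)
    finally show ?case .
  qed
  have zero: "(\<integral>\<^sup>+x\<in>cube a l. h x \<partial>lebesgue) = 0" if "0 < l" for a l
  proof -
    have "(\<lambda>k. (l / 2 ^ k) powr \<beta>) \<longlonglongrightarrow> 0"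
    proof (rule tendsto_zero_powrI[where b = \<beta>])
      show "(\<lambda>k. l / 2 ^ k) \<longlonglongrightarrow> 0"
        by (rule LIMSEQ_divide_realpow_zero) simp
    qed (use \<open>0 < l\<close> \<open>0 < \<beta>\<close> in auto)
    then have "(\<lambda>k. A * l ^ CARD('n) * (l / 2 ^ k) powr \<beta>) \<longlonglongrightarrow> 0"
      using tendsto_mult_right_zero by blast
    then have "(\<lambda>k. ennreal (A * l ^ CARD('n) * (l / 2 ^ k) powr \<beta>)) \<longlonglongrightarrow> ennreal 0"
      by (rule tendsto_ennrealI)
    then have "(\<integral>\<^sup>+x\<in>cube a l. h x \<partial>lebesgue) \<le> ennreal 0"
      by (rule LIMSEQ_le_const) (use halved[OF that] in auto)
    then show ?thesis by simp
  qed
  \<comment> \<open>Centred cubes of side 2 (k + 1) exhaust the space; \<open>Suc k\<close> keeps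
    the side positive at k = 0.\<close>
  have "AE x in lebesgue. x \<in> cube (\<chi> i. - real (Suc k)) (2 * real (Suc k)) \<longrightarrow> h x = 0" for k
  proof -
    have "AE x in lebesgue. h x * indicator (cube (\<chi> i. - real (Suc k)) (2 * real (Suc k))) x = 0"
      using zero[of "2 * real (Suc k)" "\<chi> i. - real (Suc k)"] by (simp add: nn_integral_0_iff_AE)
    then show ?thesis
      by eventually_elim (auto simp: indicator_def split: if_splits)
  qed
  then have "AE x in lebesgue. \<forall>k. x \<in> cube (\<chi> i. - real (Suc k)) (2 * real (Suc k)) \<longrightarrow> h x = 0"
    by (subst AE_all_countable) blast
  then show ?thesis
  proof eventually_elim
    case (elim x)
    obtain k where k: "norm x \<le> real k" using real_arch_simple by blast
    have "- real (Suc k) \<le> x $ i \<and> x $ i \<le> - real (Suc k) + 2 * real (Suc k)" for i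
      using component_le_norm_cart[of x i] k by (simp add: abs_le_iff)
    then have "x \<in> cube (\<chi> i. - real (Suc k)) (2 * real (Suc k))"
      by (simp add: mem_cube)
    then show ?case using elim by blast
  qed
qed

section \<open>Means over cubes and Hoelder continuous functions\<close>

text \<open>The signed, real-valued mean, in contrast to \<open>cube_avg\<close>, which averages the
  absolute value in [0, \<infinity>]; \<open>cube_avg_eq\<close> links the two.\<close>

definition avg :: "(real ^ 'n::finite \<Rightarrow> real) \<Rightarrow> real ^ 'n \<Rightarrow> real \<Rightarrow> real" where
  "avg b a l = (LINT x:cube a l|lebesgue. b x) / l ^ CARD('n)"

lemma set_integrable_cube_const [simp]: "set_integrable lebesgue (cube a l) (\<lambda>x. c :: real)"
  unfolding set_integrable_def using cube_lmeasurable[of a l]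
  by (auto simp: fmeasurable_def intro!: integrable_mult_left)

lemma LINT_cube_const:
  fixes a :: "real ^ 'n::finite"
  assumes "0 \<le> l"
  shows "(LINT x:cube a l|lebesgue. c :: real) = c * l ^ CARD('n)"
  using measure_cube[OF assms, of a] by (simp add: set_lebesgue_integral_def)

lemma set_integral_mono_set_nonneg:
  fixes f :: "'a \<Rightarrow> real"
  assumes "set_integrable M B f" "A \<in> sets M" "A \<subseteq> B" "\<And>x. 0 \<le> f x"
  shows "(LINT x:A|M. f x) \<le> (LINT x:B|M. f x)"
  unfolding set_lebesgue_integral_def
proof (rule integral_mono)
  show "integrable M (\<lambda>x. indicator A x *\<^sub>R f x)"
    using set_integrable_subset[OF assms(1-3)] by (simp add: set_integrable_def)
qed (use assms in \<open>auto simp: set_integrable_def indicator_def\<close>)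

lemma nn_integral_eq_set_integral:
  fixes f :: "'a \<Rightarrow> real"
  assumes "set_integrable M S f" "\<And>x. x \<in> S \<Longrightarrow> 0 \<le> f x"
  shows "(\<integral>\<^sup>+x\<in>S. ennreal (f x) \<partial>M) = ennreal (LINT x:S|M. f x)"
proof -
  have "(\<integral>\<^sup>+x\<in>S. ennreal (f x) \<partial>M) = (\<integral>\<^sup>+x. ennreal (indicator S x *\<^sub>R f x) \<partial>M)"
    by (intro nn_integral_cong) (auto simp: indicator_def)
  also have "\<dots> = ennreal (LINT x:S|M. f x)"
    using assms unfolding set_lebesgue_integral_def set_integrable_def
    by (intro nn_integral_eq_integral) (auto simp: indicator_def)
  finally show ?thesis .
qed

lemma holder_const_imp_continuous:
  assumes "holder_const \<beta> g C" "0 < \<beta>"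
  shows "continuous_on S g"
proof -
  have "isCont g x" for x
    unfolding isCont_def
  proof -
    have "((\<lambda>y. norm (y - x) powr \<beta>) \<longlongrightarrow> 0) (at x)"
    proof (rule tendsto_zero_powrI[where b = \<beta>])
      show "((\<lambda>y. norm (y - x)) \<longlongrightarrow> 0) (at x)"
        by (intro tendsto_norm_zero LIM_zero tendsto_ident_at)
    qed (use assms in auto)
    then have "((\<lambda>y. C * norm (y - x) powr \<beta>) \<longlongrightarrow> 0) (at x)"
      by (rule tendsto_mult_right_zero)
    then have "((\<lambda>y. g y - g x) \<longlongrightarrow> 0) (at x)"
      using assms by (elim Lim_null_comparison[rotated]) (auto simp: holder_const_def)
    then show "(g \<longlongrightarrow> g x) (at x)"
      by (simp add: LIM_zero_iff)
  qed
  then show ?thesis by (simp add: continuous_at_imp_continuous_on)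
qed

lemma holder_const_imp_measurable:
  assumes "holder_const \<beta> g C" "0 < \<beta>"
  shows "g \<in> borel_measurable lebesgue"
  using borel_measurable_continuous_onI[OF holder_const_imp_continuous[OF assms]]
  by (simp add: measurable_completion)

section \<open>From mean oscillation to a Hoelder representative\<close>

text \<open>\<open>osc\<close> is the L^1 form of Campanato's condition with the volume multiplied
  out.\<close>

locale campanato =
  fixes b :: "real ^ 'n::finite \<Rightarrow> real" and A \<beta> :: real
  assumes int: "\<And>a l. set_integrable lebesgue (cube a l) b"
    and meas [measurable]: "b \<in> borel_measurable lebesgue"
    and A_nonneg: "0 \<le> A" and \<beta>_pos: "0 < \<beta>"
    and osc: "\<And>a l. 0 < l \<Longrightarrow>
      (LINT x:cube a l|lebesgue. \<bar>b x - avg b a l\<bar>) \<le> A * l ^ CARD('n) * l powr \<beta>"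
begin

lemma int_diff: "set_integrable lebesgue (cube a l) (\<lambda>x. \<bar>b x - c\<bar>)"
  using int by (intro set_integrable_abs set_integral_diff(1)) auto

text \<open>The deviation from the mean of the large cube is integrated over the small one, then
  enlarged to the whole large cube; passing between the volumes costs (l / s)^n. The ratio 3 covers
  every later use: halving, doubling, and the cube around two points in
  \<open>g_holder\<close>.\<close>

lemma avg_diff_subcube:
  assumes "0 < s" "l \<le> 3 * s" "cube c s \<subseteq> cube a l" "0 < l"
  shows "\<bar>avg b c s - avg b a l\<bar> \<le> 3 ^ CARD('n) * A * l powr \<beta>"
proof -
  let ?m = "avg b a l"
  have "avg b c s - ?m = (LINT x:cube c s|lebesgue. b x - ?m) / s ^ CARD('n)"
    using assms by (simp add: set_integral_diff int LINT_cube_const avg_def[of b c] diff_divide_distrib)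
  then have "\<bar>avg b c s - ?m\<bar> \<le> (LINT x:cube c s|lebesgue. \<bar>b x - ?m\<bar>) / s ^ CARD('n)"
    using assms(1) set_integral_norm_bound[OF set_integral_diff(1)[OF int set_integrable_cube_const], of c s "?m"]
    by (simp add: abs_divide divide_right_mono)
  also have "\<dots> \<le> (LINT x:cube a l|lebesgue. \<bar>b x - ?m\<bar>) / s ^ CARD('n)"
    using assms by (intro divide_right_mono set_integral_mono_set_nonneg int_diff) auto
  also have "\<dots> \<le> (A * l ^ CARD('n) * l powr \<beta>) / s ^ CARD('n)"
    using assms by (intro divide_right_mono osc) auto
  also have "\<dots> = A * l powr \<beta> * (l / s) ^ CARD('n)"
    by (simp add: power_divide)
  also have "\<dots> \<le> A * l powr \<beta> * 3 ^ CARD('n)"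
    using assms A_nonneg by (intro mult_left_mono power_mono) (auto simp: field_simps)
  finally show ?thesis by (simp add: mult_ac)
qed

text \<open>\<open>D\<close> is the fixed point of \<open>D \<mapsto> A + 2\<^sup>-\<^sup>\<beta> D\<close>, so the telescoping sum over halved cubes closes.\<close>

definition D :: real where "D = A / (1 - 2 powr - \<beta>)"

lemma denom_pos: "0 < 1 - 2 powr - \<beta>"
  using \<beta>_pos powr_less_mono[of "- \<beta>" 0 2] by simp

lemma D_nonneg: "0 \<le> D"
  using denom_pos A_nonneg by (simp add: D_def)

lemma D_fixed: "D * 2 powr - \<beta> + A = D"
proof -
  have "D * (1 - 2 powr - \<beta>) = A"
    using denom_pos by (metis D_def less_irrefl nonzero_eq_divide_eq)
  then show ?thesis by (simp add: algebra_simps)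
qed

lemma D_ge: "A \<le> D"
  using D_fixed mult_nonneg_nonneg[OF D_nonneg powr_ge_zero[of 2 "- \<beta>"]] by linarith

text \<open>The side is halved at the fixed corner until it is within a factor 2 of
  \<open>s\<close>; the successive errors are dominated by a geometric series with ratio
  \<open>2 powr - \<beta>\<close>, so the bound does not depend on \<open>s\<close>.\<close>

lemma avg_diff_same_corner:
  assumes "0 < s" "s \<le> r"
  shows "\<bar>avg b x s - avg b x r\<bar> \<le> 3 ^ CARD('n) * D * r powr \<beta>"
proof -
  \<comment> \<open>Here \<open>k\<close> bounds the number of halvings, and \<open>r\<close> stays
    general because the induction hypothesis is applied at r / 2.\<close>
  have "\<bar>avg b x s - avg b x r\<bar> \<le> 3 ^ CARD('n) * D * r powr \<beta>" if "r \<le> 2 ^ k * s" "s \<le> r" for k r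
    using that
  proof (induction k arbitrary: r)
    case 0
    then have "s = r" by simp
    then show ?case using D_nonneg by simp
  next
    case (Suc k)
    have "0 < r" using Suc \<open>0 < s\<close> by linarith
    show ?case
    proof (cases "r \<le> 2 * s")
      case True
      have "\<bar>avg b x s - avg b x r\<bar> \<le> 3 ^ CARD('n) * A * r powr \<beta>"
        using Suc True \<open>0 < s\<close> by (intro avg_diff_subcube cube_subset) auto
      also have "\<dots> \<le> 3 ^ CARD('n) * D * r powr \<beta>"
        using D_ge by (intro mult_right_mono mult_left_mono) auto
      finally show ?thesis .
    next
      case False
      have "\<bar>avg b x s - avg b x (r / 2)\<bar> \<le> 3 ^ CARD('n) * D * (r / 2) powr \<beta>"
        using False Suc.prems by (intro Suc.IH) auto
      moreover have "\<bar>avg b x (r / 2) - avg b x r\<bar> \<le> 3 ^ CARD('n) * A * r powr \<beta>"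
        using \<open>0 < r\<close> by (intro avg_diff_subcube cube_subset) auto
      ultimately have "\<bar>avg b x s - avg b x r\<bar> \<le> 3 ^ CARD('n) * D * (r / 2) powr \<beta> + 3 ^ CARD('n) * A * r powr \<beta>"
        by linarith
      also have "(r / 2) powr \<beta> = 2 powr - \<beta> * r powr \<beta>"
        using \<open>0 < r\<close> by (simp add: powr_divide powr_minus_divide)
      also have "3 ^ CARD('n) * D * (2 powr - \<beta> * r powr \<beta>) + 3 ^ CARD('n) * A * r powr \<beta>
          = 3 ^ CARD('n) * (D * 2 powr - \<beta> + A) * r powr \<beta>"
        by (simp add: algebra_simps)
      also have "D * 2 powr - \<beta> + A = D"
        by (rule D_fixed)
      finally show ?thesis .
    qed
  qed
  moreover obtain k where "r / s < 2 ^ k"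
    using real_arch_pow[of 2] by auto
  then have "r \<le> 2 ^ k * s" using \<open>0 < s\<close> by (simp add: field_simps)
  ultimately show ?thesis using assms(2) by blast
qed

text \<open>The candidate for the continuous representative; \<open>Suc k\<close> avoids a cube of
  side 0, and \<open>avg_tendsto_g\<close> justifies the use of \<open>lim\<close>.\<close>

definition g :: "real ^ 'n \<Rightarrow> real" where "g x = lim (\<lambda>k. avg b x (1 / real (Suc k)))"

lemma avg_tendsto_g: "(\<lambda>k. avg b x (1 / real (Suc k))) \<longlonglongrightarrow> g x"
proof -
  have "Cauchy (\<lambda>k. avg b x (1 / real (Suc k)))"
  proof (rule metric_CauchyI)
    fix e :: real assume "0 < e"
    have "(\<lambda>k. 3 ^ CARD('n) * D * (1 / real (Suc k)) powr \<beta>) \<longlonglongrightarrow> 0"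
    proof (intro tendsto_mult_right_zero tendsto_zero_powrI[where b = \<beta>])
      show "(\<lambda>k. 1 / real (Suc k)) \<longlonglongrightarrow> 0" using LIMSEQ_inverse_real_of_nat by (simp add: inverse_eq_divide)
    qed (use \<beta>_pos in auto)
    then obtain N where N: "3 ^ CARD('n) * D * (1 / real (Suc N)) powr \<beta> < e / 2"
      using \<open>0 < e\<close> order_tendstoD(2)[of _ 0 sequentially "e / 2"]
      unfolding eventually_sequentially by (meson half_gt_zero order_refl)
    \<comment> \<open>All later means are compared with the one at scale 1 / (N + 1), so that the
      same-corner estimate is only used from smaller to larger side.\<close>
    have near: "\<bar>avg b x (1 / real (Suc k)) - avg b x (1 / real (Suc N))\<bar> < e / 2" if "N \<le> k" for k
      using avg_diff_same_corner[of "1 / real (Suc k)" "1 / real (Suc N)" x] that N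
      by (simp add: frac_le)
    show "\<exists>M. \<forall>m\<ge>M. \<forall>n\<ge>M. dist (avg b x (1 / real (Suc m))) (avg b x (1 / real (Suc n))) < e"
    proof (intro exI[of _ N] allI impI)
      fix m n assume "N \<le> m" "N \<le> n"
      then show "dist (avg b x (1 / real (Suc m))) (avg b x (1 / real (Suc n))) < e"
        using near[of m] near[of n] unfolding dist_real_def by linarith
    qed
  qed
  then show ?thesis
    unfolding g_def using Cauchy_convergent convergent_LIMSEQ_iff by blast
qed

text \<open>The same-corner estimate is uniform in the smaller side, hence survives letting that
  side tend to 0.\<close>

lemma g_avg:
  assumes "0 < r"
  shows "\<bar>g x - avg b x r\<bar> \<le> 3 ^ CARD('n) * D * r powr \<beta>"
proof (rule LIMSEQ_le_const2)
  show "(\<lambda>k. \<bar>avg b x (1 / real (Suc k)) - avg b x r\<bar>) \<longlonglongrightarrow> \<bar>g x - avg b x r\<bar>"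
    by (intro tendsto_intros avg_tendsto_g)
  obtain N where N: "1 / real (Suc N) < r"
    using reals_Archimedean[OF assms] by (auto simp: inverse_eq_divide)
  have "1 / real (Suc k) \<le> r" if "N \<le> k" for k
  proof -
    have "1 / real (Suc k) \<le> 1 / real (Suc N)" using that by (simp add: frac_le)
    then show ?thesis using N by linarith
  qed
  then show "\<exists>N. \<forall>k\<ge>N. \<bar>avg b x (1 / real (Suc k)) - avg b x r\<bar> \<le> 3 ^ CARD('n) * D * r powr \<beta>"
    using avg_diff_same_corner by (intro exI[of _ N]) auto
qed

lemma g_holder: "holder_const \<beta> g (2 * 3 ^ CARD('n) * (D + 3 powr \<beta> * A))"
  unfolding holder_const_def
proof (intro conjI allI)
  show "0 \<le> 2 * 3 ^ CARD('n) * (D + 3 powr \<beta> * A)"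
    using D_nonneg A_nonneg by simp
  fix x y :: "real ^ 'n"
  show "\<bar>g x - g y\<bar> \<le> (2 * 3 ^ CARD('n) * (D + 3 powr \<beta> * A)) * norm (x - y) powr \<beta>"
  proof (cases "x = y")
    case False
    define r where "r = norm (x - y)"
    have "0 < r" using False by (simp add: r_def)
    have comp: "\<bar>x $ i - y $ i\<bar> \<le> r" for i
      using component_le_norm_cart[of "x - y" i] by (simp add: r_def)
    \<comment> \<open>Each coordinate of \<open>y\<close> may lie up to \<open>r\<close> on either
      side of that of \<open>x\<close>, so the cube of side 3 r with this corner contains the cubes
      of side \<open>r\<close> at both points.\<close>
    define c where "c = (\<chi> i. x $ i - r)"
    have "\<bar>avg b x r - avg b c (3 * r)\<bar> \<le> 3 ^ CARD('n) * A * (3 * r) powr \<beta>"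
      using \<open>0 < r\<close> by (intro avg_diff_subcube cube_subset) (auto simp: c_def)
    moreover have "\<bar>avg b y r - avg b c (3 * r)\<bar> \<le> 3 ^ CARD('n) * A * (3 * r) powr \<beta>"
    proof (intro avg_diff_subcube cube_subset)
      show "c $ i \<le> y $ i" "y $ i + r \<le> c $ i + 3 * r" for i
        using comp[of i] by (auto simp: c_def)
    qed (use \<open>0 < r\<close> in auto)
    ultimately have "\<bar>g x - g y\<bar> \<le> 2 * (3 ^ CARD('n) * D * r powr \<beta>) + 2 * (3 ^ CARD('n) * A * (3 * r) powr \<beta>)"
      using g_avg[OF \<open>0 < r\<close>, of x] g_avg[OF \<open>0 < r\<close>, of y] by linarith
    also have "\<dots> = (2 * 3 ^ CARD('n) * (D + 3 powr \<beta> * A)) * r powr \<beta>"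
      using \<open>0 < r\<close> by (simp add: powr_mult algebra_simps)
    finally show ?thesis by (simp add: r_def)
  qed simp
qed

text \<open>\<open>g_avg\<close> only treats the cube with corner \<open>x\<close>. The cubes of
  side \<open>l\<close> with corners \<open>x\<close> and \<open>a\<close> both lie in the cube of
  side 2 l with corner \<open>a\<close>, which serves as intermediary.\<close>

lemma g_near_avg:
  assumes "0 < l" "x \<in> cube a l"
  shows "\<bar>avg b a l - g x\<bar> \<le> 3 ^ CARD('n) * (D + 2 * 2 powr \<beta> * A) * l powr \<beta>"
proof -
  have "\<bar>avg b x l - avg b a (2 * l)\<bar> \<le> 3 ^ CARD('n) * A * (2 * l) powr \<beta>"
  proof (intro avg_diff_subcube cube_subset)
    show "a $ i \<le> x $ i" "x $ i + l \<le> a $ i + 2 * l" for i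
      using assms by (auto simp: mem_cube add.commute)
  qed (use assms in auto)
  moreover have "\<bar>avg b a l - avg b a (2 * l)\<bar> \<le> 3 ^ CARD('n) * A * (2 * l) powr \<beta>"
    using assms by (intro avg_diff_subcube cube_subset) auto
  ultimately have "\<bar>avg b a l - g x\<bar>
      \<le> 3 ^ CARD('n) * D * l powr \<beta> + 2 * (3 ^ CARD('n) * A * (2 * l) powr \<beta>)"
    using g_avg[OF assms(1), of x] by linarith
  also have "\<dots> = 3 ^ CARD('n) * (D + 2 * 2 powr \<beta> * A) * l powr \<beta>"
    using assms(1) by (simp add: powr_mult algebra_simps)
  finally show ?thesis .
qed

lemma AE_eq_g: "AE x in lebesgue. b x = g x"
proof -
  have [measurable]: "g \<in> borel_measurable lebesgue"
    using holder_const_imp_measurable[OF g_holder \<beta>_pos] .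
  define E where "E = 3 ^ CARD('n) * (D + 2 * 2 powr \<beta> * A)"
  have "0 \<le> E" using D_nonneg A_nonneg by (simp add: E_def)
  have "AE x in lebesgue. ennreal \<bar>b x - g x\<bar> = 0"
  proof (rule AE_zero_if_cube_integrals_small)
    show "0 < \<beta>" by (rule \<beta>_pos)
    show "0 \<le> A + E" using A_nonneg \<open>0 \<le> E\<close> by simp
    fix a :: "real ^ 'n" and l :: real assume "0 < l"
    \<comment> \<open>Triangle inequality through the mean: the first term is integrated by
      \<open>osc\<close>, the second bounds the distance from the mean to \<open>g\<close> uniformly
      on the cube.\<close>
    let ?h = "\<lambda>x. \<bar>b x - avg b a l\<bar> + E * l powr \<beta>"
    have "\<bar>b x - g x\<bar> \<le> ?h x" if "x \<in> cube a l" for x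
      using g_near_avg[OF \<open>0 < l\<close> that] unfolding E_def by linarith
    then have "(\<integral>\<^sup>+x\<in>cube a l. ennreal \<bar>b x - g x\<bar> \<partial>lebesgue) \<le> (\<integral>\<^sup>+x\<in>cube a l. ennreal (?h x) \<partial>lebesgue)"
      by (intro nn_integral_mono) (auto simp: indicator_def intro!: ennreal_leI)
    also have "\<dots> = ennreal (LINT x:cube a l|lebesgue. ?h x)"
      using \<open>0 \<le> E\<close> by (intro nn_integral_eq_set_integral set_integral_add(1) int_diff) auto
    also have "(LINT x:cube a l|lebesgue. ?h x)
        = (LINT x:cube a l|lebesgue. \<bar>b x - avg b a l\<bar>) + E * l powr \<beta> * l ^ CARD('n)"
      using \<open>0 < l\<close> by (simp add: set_integral_add(2) int_diff LINT_cube_const)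
    also have "ennreal \<dots> \<le> ennreal ((A + E) * l ^ CARD('n) * l powr \<beta>)"
      using osc[OF \<open>0 < l\<close>, of a] by (intro ennreal_leI) (simp add: algebra_simps)
    finally show "(\<integral>\<^sup>+x\<in>cube a l. ennreal \<bar>b x - g x\<bar> \<partial>lebesgue)
      \<le> ennreal ((A + E) * l ^ CARD('n) * l powr \<beta>)" .
  qed measurable
  then show ?thesis by eventually_elim simp
qed

end

section \<open>The variable exponent norm\<close>

lemma ennpowr_mono:
  assumes "t \<le> u" "0 \<le> p"
  shows "ennpowr t p \<le> ennpowr u p"
proof (cases "u = \<infinity>")
  case False
  then have "t \<noteq> \<infinity>" "enn2real t \<le> enn2real u"
    using assms(1) by (auto simp: top_unique enn2real_mono less_top)
  with False assms(2) show ?thesis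
    by (auto simp: ennpowr_def intro!: ennreal_leI powr_mono2)
qed (simp add: ennpowr_def)

lemma var_modular_mono:
  assumes "AE x in lebesgue. \<bar>f x\<bar> \<le> \<bar>h x\<bar>" "\<And>x. 0 \<le> p x"
  shows "var_modular p f s \<le> var_modular p h s"
  unfolding var_modular_def
proof (rule nn_integral_mono_AE)
  show "AE x in lebesgue. ennpowr (e2ennreal \<bar>f x\<bar> / ennreal s) (p x) \<le> ennpowr (e2ennreal \<bar>h x\<bar> / ennreal s) (p x)"
    using assms(1)
    by eventually_elim (intro ennpowr_mono divide_right_mono_ennreal e2ennreal_mono assms(2))
qed

lemma var_norm_mono:
  assumes "AE x in lebesgue. \<bar>f x\<bar> \<le> \<bar>h x\<bar>" "\<And>x. 0 \<le> p x"
  shows "var_norm p f \<le> var_norm p h"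
  unfolding var_norm_def
  by (rule INF_superset_mono) (auto intro: order_trans[OF var_modular_mono[OF assms]])

lemma var_modular_cmult:
  assumes "0 < c" "0 < s"
  shows "var_modular p (\<lambda>x. ereal c * f x) s = var_modular p f (s / c)"
proof -
  have "e2ennreal \<bar>ereal c * f x\<bar> / ennreal s = e2ennreal \<bar>f x\<bar> / ennreal (s / c)" for x
  proof (cases "f x")
    case (real r)
    then show ?thesis
      using assms by (simp add: abs_mult divide_ennreal mult.commute)
  qed (use assms in \<open>simp_all add: ennreal_top_divide\<close>)
  then show ?thesis by (simp add: var_modular_def)
qed

text \<open>A scale \<open>s\<close> admissible for the multiple gives the scale s / c for
  \<open>f\<close>. The opposite inequality in \<open>var_norm_cmult\<close> is this one for the
  factor 1 / c.\<close>

lemma var_norm_cmult_ge: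
  assumes "0 < c"
  shows "ennreal c * var_norm p f \<le> var_norm p (\<lambda>x. ereal c * f x)"
  unfolding var_norm_def[of p "\<lambda>x. ereal c * f x"]
proof (rule INF_greatest)
  fix s :: real assume s: "s \<in> {s. 0 < s \<and> var_modular p (\<lambda>x. ereal c * f x) s \<le> 1}"
  then have "var_norm p f \<le> ennreal (s / c)"
    unfolding var_norm_def using assms by (intro INF_lower) (auto simp: var_modular_cmult)
  then have "ennreal c * var_norm p f \<le> ennreal c * ennreal (s / c)"
    by (intro mult_left_mono) auto
  also have "\<dots> = ennreal s"
    using assms s by (simp flip: ennreal_mult')
  finally show "ennreal c * var_norm p f \<le> ennreal s" .
qed

lemma var_norm_zero: "var_norm p (\<lambda>x. 0) = 0"
proof -
  have "var_norm p (\<lambda>x. 0) \<le> ennreal e" if "0 < e" for e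
    \<comment> \<open>Every positive scale is admissible, since \<open>0 powr p\<close> is 0 for all
      \<open>p\<close>.\<close>
    unfolding var_norm_def using that
    by (intro INF_lower) (simp add: var_modular_def ennpowr_def e2ennreal_neg)
  then have "var_norm p (\<lambda>x. 0) \<le> 0"
    by (intro ennreal_le_epsilon[of 0]) simp
  then show ?thesis by simp
qed

lemma var_norm_cmult:
  assumes "0 \<le> c"
  shows "var_norm p (\<lambda>x. ereal c * f x) = ennreal c * var_norm p f"
proof (cases "c = 0")
  \<comment> \<open>With 0 * \<infinity> = 0 in both \<open>ereal\<close> and
    \<open>ennreal\<close>, both sides vanish even where \<open>f\<close> or its norm is
    infinite.\<close>
  case True
  then show ?thesis by (simp add: var_norm_zero flip: zero_ereal_def)
next
  case False
  with assms have "0 < c" by simp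
  have "(\<lambda>x. ereal (1 / c) * (ereal c * f x)) = f"
    using \<open>0 < c\<close> by (simp flip: mult.assoc one_ereal_def)
  then have "ennreal (1 / c) * var_norm p (\<lambda>x. ereal c * f x) \<le> var_norm p f"
    using var_norm_cmult_ge[of "1 / c" p "\<lambda>x. ereal c * f x"] \<open>0 < c\<close> by simp
  then have "ennreal c * (ennreal (1 / c) * var_norm p (\<lambda>x. ereal c * f x)) \<le> ennreal c * var_norm p f"
    by (intro mult_left_mono) auto
  then have "var_norm p (\<lambda>x. ereal c * f x) \<le> ennreal c * var_norm p f"
    using \<open>0 < c\<close> by (simp flip: mult.assoc ennreal_mult')
  then show ?thesis
    using var_norm_cmult_ge[OF \<open>0 < c\<close>] by (intro antisym)
qed

lemma var_modular_indicator:
  assumes "0 < s"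
  shows "var_modular p (indicator Q) s = (\<integral>\<^sup>+x\<in>Q. ennreal ((1 / s) powr p x) \<partial>lebesgue)"
  unfolding var_modular_def
proof (intro nn_integral_cong)
  fix x
  have "1 / ennreal s = ennreal (1 / s)"
    using assms divide_ennreal[of 1 s] by simp
  then show "ennpowr (e2ennreal \<bar>indicator Q x\<bar> / ennreal s) (p x) = ennreal ((1 / s) powr p x) * indicator Q x"
    using assms e2ennreal_ereal[of 1] by (simp add: indicator_def ennpowr_def e2ennreal_neg one_ereal_def)
qed

lemma var_norm_cube_finite:
  fixes a :: "real ^ 'n::finite"
  assumes "0 < l" "\<And>x. 1 \<le> p x"
  shows "var_norm p (indicator (cube a l)) < \<infinity>"
proof -
  \<comment> \<open>The bound 1 on \<open>s\<close> yields (1/s)^p \<le> 1/s, as p is at least 1;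
    the bound by the volume then makes the modular at most 1.\<close>
  obtain s where s: "1 \<le> s" "l ^ CARD('n) \<le> s"
    by (meson linear order_trans order_refl)
  have "var_modular p (indicator (cube a l)) s \<le> (\<integral>\<^sup>+x\<in>cube a l. ennreal (1 / s) \<partial>lebesgue)"
  proof (subst var_modular_indicator)
    show "(\<integral>\<^sup>+x\<in>cube a l. ennreal ((1 / s) powr p x) \<partial>lebesgue) \<le> (\<integral>\<^sup>+x\<in>cube a l. ennreal (1 / s) \<partial>lebesgue)"
    proof (intro nn_integral_mono mult_right_mono ennreal_leI)
      fix x
      show "(1 / s) powr p x \<le> 1 / s"
        using powr_mono'[OF assms(2)[of x], of "1 / s"] s by simp
    qed simp
  qed (use s in simp)
  also have "\<dots> = ennreal (1 / s * l ^ CARD('n))"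
    using assms(1) s by (simp add: nn_integral_cmult_indicator emeasure_cube del: emeasure_completion flip: ennreal_mult)
  also have "\<dots> \<le> ennreal 1"
    using s by (intro ennreal_leI) simp
  finally have "var_norm p (indicator (cube a l)) \<le> ennreal s"
    unfolding var_norm_def by (intro INF_lower) (use s in simp)
  then show ?thesis using ennreal_less_top[of s] by (auto intro: le_less_trans)
qed

text \<open>An admissible scale below 1 satisfies 1/s \<le> (1/s)^p, so the volume divided by
  \<open>s\<close> is at most 1. Hence the norm is at least the minimum of 1 and the volume.
  Together with finiteness this allows cancelling the norm of a cube's indicator.\<close>

lemma var_norm_cube_pos:
  fixes a :: "real ^ 'n::finite"
  assumes "0 < l" "\<And>x. 1 \<le> p x"
  shows "0 < var_norm p (indicator (cube a l))"
proof -
  have "ennreal (min 1 (l ^ CARD('n))) \<le> var_norm p (indicator (cube a l))"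
    unfolding var_norm_def
  proof (rule INF_greatest)
    fix s :: real assume "s \<in> {s. 0 < s \<and> var_modular p (indicator (cube a l)) s \<le> 1}"
    then have s: "0 < s" "var_modular p (indicator (cube a l)) s \<le> 1" by auto
    have "l ^ CARD('n) \<le> s" if "s < 1"
    proof -
      have "ennreal (1 / s * l ^ CARD('n)) = (\<integral>\<^sup>+x\<in>cube a l. ennreal (1 / s) \<partial>lebesgue)"
        using assms(1) s by (simp add: nn_integral_cmult_indicator emeasure_cube del: emeasure_completion flip: ennreal_mult)
      also have "\<dots> \<le> (\<integral>\<^sup>+x\<in>cube a l. ennreal ((1 / s) powr p x) \<partial>lebesgue)"
      proof (intro nn_integral_mono mult_right_mono ennreal_leI)
        fix x
        show "1 / s \<le> (1 / s) powr p x"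
          using powr_mono[OF assms(2)[of x], of "1 / s"] s that by simp
      qed simp
      also have "\<dots> \<le> 1" using s by (simp add: var_modular_indicator)
      finally have "1 / s * l ^ CARD('n) \<le> 1" by simp
      then show ?thesis using s by (simp add: field_simps)
    qed
    then show "ennreal (min 1 (l ^ CARD('n))) \<le> ennreal s"
      by (intro ennreal_leI) linarith
  qed
  moreover have "0 < ennreal (min 1 (l ^ CARD('n)))" using assms(1) by simp
  ultimately show ?thesis by (rule less_le_trans[rotated])
qed

section \<open>From the starred norm to nonnegativity and mean oscillation\<close>

lemma measure_cube_powr:
  fixes a :: "real ^ 'n::finite"
  assumes "0 < l"
  shows "measure lebesgue (cube a l) powr (\<beta> / real CARD('n)) = l powr \<beta>"
  using assms measure_cube[of l a] by (simp add: powr_powr flip: powr_realpow)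

lemma L1_loc_integrable_cube: "b \<in> L1_loc \<Longrightarrow> set_integrable lebesgue (cube a l) b"
  by (auto simp: L1_loc_def cube_def)

lemma cube_avg_eq:
  fixes a :: "real ^ 'n::finite"
  assumes "0 < l" "set_integrable lebesgue (cube a l) b"
  shows "cube_avg b (cube a l) = ennreal (avg (\<lambda>x. \<bar>b x\<bar>) a l)"
proof -
  have "(\<integral>\<^sup>+x\<in>cube a l. ennreal \<bar>b x\<bar> \<partial>lebesgue) = ennreal (LINT x:cube a l|lebesgue. \<bar>b x\<bar>)"
    using assms by (intro nn_integral_eq_set_integral set_integrable_abs) auto
  moreover have "0 \<le> (LINT x:cube a l|lebesgue. \<bar>b x\<bar>)"
    by (simp add: set_lebesgue_integral_def)
  ultimately show ?thesis
    using assms(1) by (simp add: cube_avg_def avg_def emeasure_cube divide_ennreal del: emeasure_completion)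
qed

lemma set_integrable_max_diff:
  fixes b :: "real ^ 'n::finite \<Rightarrow> real"
  assumes "set_integrable lebesgue (cube a l) b"
  shows "set_integrable lebesgue (cube a l) (\<lambda>x. max 0 (c - b x))"
proof -
  have "set_integrable lebesgue (cube a l) (\<lambda>x. ((c - b x) + \<bar>c - b x\<bar>) / 2)"
    using assms by (intro set_integrable_divide set_integral_add(1) set_integrable_abs set_integral_diff(1)) auto
  moreover have "(\<lambda>x. ((c - b x) + \<bar>c - b x\<bar>) / 2) = (\<lambda>x. max 0 (c - b x))"
    by (auto simp: max_def)
  ultimately show ?thesis by simp
qed

text \<open>The cube itself competes in the supremum, so its mean of |b| is at most the local
  maximal function on it. Where \<open>b\<close> lies below that mean, the gap to the maximal
  function is at least as large; elsewhere the truncation is 0. At points where the maximal function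
  is infinite, so is the right side.\<close>

lemma abs_trunc_le_diff_local_maximal:
  assumes "0 < l" "set_integrable lebesgue (cube a l) b"
  shows "\<bar>ereal (max 0 (avg (\<lambda>x. \<bar>b x\<bar>) a l - b x) * indicator (cube a l) x)\<bar>
    \<le> \<bar>(ereal (b x) - enn2ereal (local_maximal (cube a l) b x)) * indicator (cube a l) x\<bar>"
proof (cases "x \<in> cube a l")
  case True
  let ?c = "avg (\<lambda>x. \<bar>b x\<bar>) a l"
  have "ennreal ?c \<le> local_maximal (cube a l) b x"
    unfolding local_maximal_def cube_avg_eq[OF assms, symmetric]
    using True assms(1) by (intro SUP_upper) (auto simp: cubes_eq)
  then show ?thesis
  proof (cases "local_maximal (cube a l) b x" rule: ennreal_cases)
    case (real r)
    then have "?c \<le> r"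
      using \<open>ennreal ?c \<le> _\<close> by simp
    then have "\<bar>max 0 (?c - b x)\<bar> \<le> \<bar>b x - r\<bar>" by (simp add: max_def abs_le_iff)
    then show ?thesis using True real by (simp del: ereal_max)
  next
    case top
    then show ?thesis using True by simp
  qed
qed simp

text \<open>Clears the denominators in \<open>Lip_star_norm\<close>. An infinite \<open>V\<close>
  would make the scaled quotient infinite, against the finite bound.\<close>

lemma ennreal_le_of_scaled_quotient:
  assumes "1 / ennreal u * (V / ennreal N) \<le> ennreal K" "0 < u" "0 < N" "0 \<le> K"
  shows "V \<le> ennreal (K * u * N)"
proof -
  have u: "1 / ennreal u = ennreal (1 / u)"
    using \<open>0 < u\<close> divide_ennreal[of 1 u] by simp
  show ?thesis
  proof (cases V rule: ennreal_cases)
    case (real r)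
    then have "ennreal (1 / u * (r / N)) \<le> ennreal K"
      using assms u by (simp add: divide_ennreal flip: ennreal_mult)
    then have "1 / u * (r / N) \<le> K"
      using assms by simp
    then show ?thesis
      using assms real by (simp add: field_simps ennreal_leI)
  next
    case top
    then show ?thesis
      using assms u by (simp add: ennreal_top_divide ennreal_mult_top top_unique)
  qed
qed

text \<open>Boundedness of the maximal operator replaces the variable-exponent Hoelder inequality: the
  maximal function of a function supported in the cube dominates its average on the whole cube.\<close>

lemma one_sided_osc_of_Lip_star:
  fixes q b :: "real ^ 'n::finite \<Rightarrow> real"
  assumes q: "\<And>x. 1 \<le> q x"
    and bdd: "\<And>f. f \<in> var_Lp q \<Longrightarrow>
      var_norm q (\<lambda>x. enn2ereal (HL_maximal f x)) \<le> ennreal C * var_norm q (\<lambda>x. ereal (f x))"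
    and "0 \<le> C" "0 \<le> K" "0 < l"
    and b: "b \<in> L1_loc" and K: "Lip_star_norm \<beta> q b \<le> ennreal K"
  shows "(LINT x:cube a l|lebesgue. max 0 (avg (\<lambda>x. \<bar>b x\<bar>) a l - b x)) \<le> C * K * l ^ CARD('n) * l powr \<beta>"
proof -
  let ?Q = "cube a l" and ?c = "avg (\<lambda>x. \<bar>b x\<bar>) a l"
  let ?F = "\<lambda>x. (ereal (b x) - enn2ereal (local_maximal ?Q b x)) * indicator ?Q x"
  define f where "f = (\<lambda>x. max 0 (?c - b x) * indicator ?Q x)"
  have q0: "0 \<le> q x" for x using q[of x] by linarith
  have int: "set_integrable lebesgue ?Q b" by (rule L1_loc_integrable_cube[OF b])
  have [measurable]: "b \<in> borel_measurable lebesgue" using b by (simp add: L1_loc_def)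
  obtain N where N: "var_norm q (indicator ?Q) = ennreal N" "0 < N"
    using var_norm_cube_finite[OF \<open>0 < l\<close>, of q a, OF q] var_norm_cube_pos[OF \<open>0 < l\<close>, of q a, OF q]
    by (metis ennreal_cases ennreal_0 infinity_ennreal_def less_irrefl order_le_less)
  have "1 / ennreal (l powr \<beta>) * (var_norm q ?F / ennreal N) \<le> Lip_star_norm \<beta> q b"
    unfolding Lip_star_norm_def using \<open>0 < l\<close>
    by (intro SUP_upper2[of ?Q]) (auto simp: cubes_eq measure_cube_powr N simp del: measure_completion)
  then have "1 / ennreal (l powr \<beta>) * (var_norm q ?F / ennreal N) \<le> ennreal K"
    using K by (rule order_trans)
  then have F: "var_norm q ?F \<le> ennreal (K * l powr \<beta> * N)"
    by (rule ennreal_le_of_scaled_quotient) (use \<open>0 < l\<close> \<open>0 \<le> K\<close> N in auto)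
  have "var_norm q (\<lambda>x. ereal (f x)) \<le> var_norm q ?F"
    unfolding f_def using abs_trunc_le_diff_local_maximal[OF \<open>0 < l\<close> int]
    by (intro var_norm_mono q0) simp
  with F have f_norm: "var_norm q (\<lambda>x. ereal (f x)) \<le> ennreal (K * l powr \<beta> * N)"
    by (rule order_trans[rotated])
  \<comment> \<open>\<open>bdd\<close> is available on \<open>var_Lp\<close> only; the finite norm
    supplies a scale with modular at most 1.\<close>
  have "f \<in> var_Lp q"
  proof -
    have "var_norm q (\<lambda>x. ereal (f x)) < \<infinity>"
      using f_norm by (rule le_less_trans) simp
    then obtain s where "0 < s" "var_modular q (\<lambda>x. ereal (f x)) s \<le> 1"
      unfolding var_norm_def by (auto simp: INF_less_iff)
    then have "\<exists>s>0. var_modular q (\<lambda>x. ereal (f x)) s < \<infinity>"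
      by (intro exI[of _ s]) (auto intro: le_less_trans)
    moreover have "f \<in> borel_measurable lebesgue"
      unfolding f_def by measurable
    ultimately show ?thesis by (simp add: var_Lp_def)
  qed
  have f_nonneg: "0 \<le> f x" for x by (simp add: f_def)
  have f_int: "set_integrable lebesgue ?Q f" and f_LINT: "(LINT x:?Q|lebesgue. f x) = (LINT x:?Q|lebesgue. max 0 (?c - b x))"
  proof -
    have "(\<lambda>x. indicator ?Q x *\<^sub>R f x) = (\<lambda>x. indicator ?Q x *\<^sub>R max 0 (?c - b x))"
      by (auto simp: f_def indicator_def)
    then show "set_integrable lebesgue ?Q f" "(LINT x:?Q|lebesgue. f x) = (LINT x:?Q|lebesgue. max 0 (?c - b x))"
      using set_integrable_max_diff[OF int, of ?c] by (simp_all add: set_integrable_def set_lebesgue_integral_def)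
  qed
  have avg_f: "cube_avg f ?Q = ennreal (avg f a l)"
    using cube_avg_eq[OF \<open>0 < l\<close> f_int] f_nonneg by simp
  have avg_f_nonneg: "0 \<le> avg f a l"
    using \<open>0 < l\<close> f_nonneg by (simp add: avg_def set_lebesgue_integral_def)
  \<comment> \<open>Start of the chain: the mean of \<open>f\<close> times \<open>N\<close> is at
    most the norm of the maximal function, hence at most C K l^\<beta> N; the positive finite
    \<open>N\<close> then cancels.\<close>
  have "ennreal (avg f a l) * ennreal N = var_norm q (\<lambda>x. ereal (avg f a l) * indicator ?Q x)"
    by (simp add: var_norm_cmult avg_f_nonneg N)
  also have "\<dots> \<le> var_norm q (\<lambda>x. enn2ereal (HL_maximal f x))"
  proof (intro var_norm_mono q0 AE_I2)
    fix x
    show "\<bar>ereal (avg f a l) * indicator ?Q x\<bar> \<le> \<bar>enn2ereal (HL_maximal f x)\<bar>"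
    proof (cases "x \<in> ?Q")
      case True
      have "ennreal (avg f a l) \<le> HL_maximal f x"
        unfolding HL_maximal_def avg_f[symmetric]
        using True \<open>0 < l\<close> by (intro SUP_upper) (auto simp: cubes_eq)
      then have "enn2ereal (ennreal (avg f a l)) \<le> enn2ereal (HL_maximal f x)"
        by (simp add: less_eq_ennreal.rep_eq)
      then show ?thesis
        using True avg_f_nonneg by (simp add: abs_ereal_ge0)
    qed simp
  qed
  also have "\<dots> \<le> ennreal C * var_norm q (\<lambda>x. ereal (f x))"
    by (rule bdd) fact
  also have "\<dots> \<le> ennreal C * ennreal (K * l powr \<beta> * N)"
    by (intro mult_left_mono f_norm) simp
  finally have "ennreal (avg f a l * N) \<le> ennreal (C * (K * l powr \<beta> * N))"
    using avg_f_nonneg N \<open>0 \<le> C\<close> \<open>0 \<le> K\<close> by (simp add: ennreal_mult)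
  then have "avg f a l * N \<le> C * K * l powr \<beta> * N"
    using N \<open>0 \<le> C\<close> \<open>0 \<le> K\<close> by (simp add: mult_ac)
  then have "avg f a l \<le> C * K * l powr \<beta>"
    using N by simp
  then show ?thesis
    using \<open>0 < l\<close> by (simp add: avg_def f_LINT divide_le_eq mult_ac)
qed

lemma AE_nonneg_if_one_sided:
  fixes b :: "real ^ 'n::finite \<Rightarrow> real"
  assumes b: "b \<in> L1_loc" and "0 < \<beta>" "0 \<le> B"
    and osc: "\<And>a l. 0 < l \<Longrightarrow>
      (LINT x:cube a l|lebesgue. max 0 (avg (\<lambda>x. \<bar>b x\<bar>) a l - b x)) \<le> B * l ^ CARD('n) * l powr \<beta>"
  shows "AE x in lebesgue. 0 \<le> b x"
proof -
  have [measurable]: "b \<in> borel_measurable lebesgue" using b by (simp add: L1_loc_def)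
  note int = L1_loc_integrable_cube[OF b]
  have "AE x in lebesgue. ennreal (\<bar>b x\<bar> - b x) = 0"
  proof (rule AE_zero_if_cube_integrals_small)
    fix a :: "real ^ 'n" and l :: real assume "0 < l"
    let ?c = "avg (\<lambda>x. \<bar>b x\<bar>) a l"
    have "(LINT x:cube a l|lebesgue. \<bar>b x\<bar> - b x) = (LINT x:cube a l|lebesgue. ?c - b x)"
      \<comment> \<open>Replacing |b| by its own mean over the cube leaves the integral
        unchanged.\<close>
      using \<open>0 < l\<close> by (simp add: set_integral_diff int set_integrable_abs LINT_cube_const avg_def)
    also have "\<dots> \<le> (LINT x:cube a l|lebesgue. max 0 (?c - b x))"
      by (intro set_integral_mono set_integrable_max_diff set_integral_diff(1) int) auto
    also have "\<dots> \<le> B * l ^ CARD('n) * l powr \<beta>"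
      by (rule osc) fact
    finally show "(\<integral>\<^sup>+x\<in>cube a l. ennreal (\<bar>b x\<bar> - b x) \<partial>lebesgue) \<le> ennreal (B * l ^ CARD('n) * l powr \<beta>)"
      by (subst nn_integral_eq_set_integral)
        (auto intro!: set_integral_diff(1) set_integrable_abs int ennreal_leI)
  qed (use assms in auto)
  then show ?thesis by eventually_elim (simp add: ennreal_eq_0_iff)
qed

lemma campanato_if_one_sided:
  fixes b :: "real ^ 'n::finite \<Rightarrow> real"
  assumes b: "b \<in> L1_loc" and "0 < \<beta>" "0 \<le> B"
    and osc: "\<And>a l. 0 < l \<Longrightarrow>
      (LINT x:cube a l|lebesgue. max 0 (avg (\<lambda>x. \<bar>b x\<bar>) a l - b x)) \<le> B * l ^ CARD('n) * l powr \<beta>"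
  shows "campanato b (2 * B) \<beta>"
proof
  note int = L1_loc_integrable_cube[OF b]
  show "set_integrable lebesgue (cube a l) b" for a l by (rule int)
  show [measurable]: "b \<in> borel_measurable lebesgue" using b by (simp add: L1_loc_def)
  show "0 \<le> 2 * B" "0 < \<beta>" using assms by auto
  fix a :: "real ^ 'n" and l :: real assume "0 < l"
  have "AE x in lebesgue. 0 \<le> b x" using AE_nonneg_if_one_sided assms by blast
  then have "AE x in lebesgue. x \<in> cube a l \<longrightarrow> \<bar>b x\<bar> = b x"
    by eventually_elim simp
  then have "(LINT x:cube a l|lebesgue. \<bar>b x\<bar>) = (LINT x:cube a l|lebesgue. b x)"
    by (intro set_lebesgue_integral_cong_AE) auto
  then have avg_abs: "avg (\<lambda>x. \<bar>b x\<bar>) a l = avg b a l"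
    by (simp add: avg_def)
  let ?m = "avg b a l"
  \<comment> \<open>From |t| = 2 max(0, t) - t with t = m - b: the linear term integrates to 0
    because m is the mean of \<open>b\<close>, which gives the factor 2 in the constant.\<close>
  have "(LINT x:cube a l|lebesgue. \<bar>b x - ?m\<bar>) = (LINT x:cube a l|lebesgue. 2 * max 0 (?m - b x) - (?m - b x))"
    by (rule arg_cong[where f = "set_lebesgue_integral _ _"]) (auto simp: max_def)
  also have "\<dots> = 2 * (LINT x:cube a l|lebesgue. max 0 (?m - b x)) - (LINT x:cube a l|lebesgue. ?m - b x)"
    using set_integrable_max_diff[OF int] int by (subst set_integral_diff(2)) auto
  also have "(LINT x:cube a l|lebesgue. ?m - b x) = 0"
    using \<open>0 < l\<close> by (simp add: set_integral_diff int LINT_cube_const avg_def)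
  finally show "(LINT x:cube a l|lebesgue. \<bar>b x - ?m\<bar>) \<le> 2 * B * l ^ CARD('n) * l powr \<beta>"
    using osc[OF \<open>0 < l\<close>, of a] by (simp add: avg_abs)
qed

section \<open>From Hoelder continuity to the starred norm\<close>

text \<open>Estimated through the sum of the coordinates; the factor n is the source of n^\<beta> in
  the upper norm bound.\<close>

lemma norm_diff_le_cube:
  fixes a :: "real ^ 'n::finite"
  assumes "x \<in> cube a l" "y \<in> cube a l"
  shows "norm (x - y) \<le> real CARD('n) * l"
proof -
  have "norm (x - y) \<le> (\<Sum>i\<in>UNIV. \<bar>(x - y) $ i\<bar>)"
    by (rule norm_le_l1_cart)
  also have "\<dots> \<le> (\<Sum>i\<in>(UNIV :: 'n set). l)"
  proof (rule sum_mono)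
    fix i
    have "a $ i \<le> x $ i" "x $ i \<le> a $ i + l" "a $ i \<le> y $ i" "y $ i \<le> a $ i + l"
      using assms by (auto simp: mem_cube)
    then show "\<bar>(x - y) $ i\<bar> \<le> l" by (simp add: abs_le_iff)
  qed
  finally show ?thesis by simp
qed

lemma cube_avg_const:
  fixes a :: "real ^ 'n::finite"
  assumes "0 < l"
  shows "(\<integral>\<^sup>+x\<in>cube a l. c \<partial>lebesgue) / emeasure lebesgue (cube a l) = c"
proof -
  have "(\<integral>\<^sup>+x\<in>cube a l. c \<partial>lebesgue) = c * emeasure lebesgue (cube a l)"
    by (rule nn_integral_cmult_indicator) simp
  moreover have "emeasure lebesgue (cube a l) \<noteq> 0" "emeasure lebesgue (cube a l) \<noteq> top"
    using assms by (simp_all add: emeasure_cube del: emeasure_completion)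
  ultimately show ?thesis
    using mult_divide_eq_ennreal by metis
qed

lemma cube_avg_le:
  assumes "0 < l" "AE y in lebesgue. y \<in> cube a l \<longrightarrow> \<bar>b y\<bar> \<le> c"
  shows "cube_avg b (cube a l) \<le> ennreal c"
proof -
  have "(\<integral>\<^sup>+y\<in>cube a l. ennreal \<bar>b y\<bar> \<partial>lebesgue) \<le> (\<integral>\<^sup>+y\<in>cube a l. ennreal c \<partial>lebesgue)"
    by (rule nn_integral_mono_AE) (use assms(2) in eventually_elim, auto simp: indicator_def intro: ennreal_leI)
  then show ?thesis
    unfolding cube_avg_def using cube_avg_const[OF assms(1), of "ennreal c" a]
    by (metis divide_right_mono_ennreal)
qed

lemma cube_avg_ge:
  assumes "0 < l" "AE y in lebesgue. y \<in> cube a l \<longrightarrow> c \<le> \<bar>b y\<bar>"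
  shows "ennreal c \<le> cube_avg b (cube a l)"
proof -
  have "(\<integral>\<^sup>+y\<in>cube a l. ennreal c \<partial>lebesgue) \<le> (\<integral>\<^sup>+y\<in>cube a l. ennreal \<bar>b y\<bar> \<partial>lebesgue)"
    by (rule nn_integral_mono_AE) (use assms(2) in eventually_elim, auto simp: indicator_def intro: ennreal_leI)
  then show ?thesis
    unfolding cube_avg_def using cube_avg_const[OF assms(1), of "ennreal c" a]
    by (metis divide_right_mono_ennreal)
qed

text \<open>Averages over all competing subcubes are at most b(x) + \<delta>, and the full cube
  alone already gives at least b(x) - \<delta>. The hypothesis compares |b(y)| with b(x) because
  averages see |b|.\<close>

lemma diff_local_maximal_le:
  fixes b :: "real ^ 'n::finite \<Rightarrow> real"
  assumes "0 < l" "x \<in> cube a l"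
    and AE: "AE y in lebesgue. y \<in> cube a l \<longrightarrow> \<bar>\<bar>b y\<bar> - b x\<bar> \<le> \<delta>"
    and "0 \<le> \<delta>" "0 \<le> b x"
  shows "\<bar>ereal (b x) - enn2ereal (local_maximal (cube a l) b x)\<bar> \<le> ereal \<delta>"
proof -
  have upper: "local_maximal (cube a l) b x \<le> ennreal (b x + \<delta>)"
    unfolding local_maximal_def
  proof (rule SUP_least)
    fix Q assume "Q \<in> {Q \<in> cubes. x \<in> Q \<and> Q \<subseteq> cube a l}"
    then obtain a' l' where Q: "Q = cube a' l'" "0 < l'" "Q \<subseteq> cube a l" by (auto simp: cubes_eq)
    have "AE y in lebesgue. y \<in> cube a' l' \<longrightarrow> \<bar>b y\<bar> \<le> b x + \<delta>"
      using AE by eventually_elim (use Q in auto)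
    then show "cube_avg b Q \<le> ennreal (b x + \<delta>)"
      unfolding Q(1) by (rule cube_avg_le[OF Q(2)])
  qed
  have "AE y in lebesgue. y \<in> cube a l \<longrightarrow> b x - \<delta> \<le> \<bar>b y\<bar>"
    using AE by eventually_elim auto
  then have "ennreal (b x - \<delta>) \<le> cube_avg b (cube a l)"
    by (rule cube_avg_ge[OF assms(1)])
  also have "\<dots> \<le> local_maximal (cube a l) b x"
    unfolding local_maximal_def using assms by (intro SUP_upper) (auto simp: cubes_eq)
  finally have lower: "ennreal (b x - \<delta>) \<le> local_maximal (cube a l) b x" .
  obtain r where r: "local_maximal (cube a l) b x = ennreal r" "0 \<le> r"
    using upper by (cases "local_maximal (cube a l) b x" rule: ennreal_cases) (auto simp: top_unique)
  have "r \<le> b x + \<delta>"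
    using upper r assms by (simp del: ennreal_plus)
  \<comment> \<open>\<open>ennreal\<close> sends negative reals to 0, so when b(x) - \<delta> is not
    positive the bound comes from \<open>0 \<le> r\<close> instead.\<close>
  moreover have "b x - \<delta> \<le> r"
    using lower r by (cases "b x - \<delta> \<le> 0") auto
  ultimately show ?thesis using r by (simp add: abs_le_iff)
qed

lemma Lip_star_norm_le_holder_const:
  fixes b g :: "real ^ 'n::finite \<Rightarrow> real"
  assumes "0 < \<beta>" and q: "\<And>x. 1 \<le> q x"
    and bg: "AE x in lebesgue. b x = g x" and nonneg: "AE x in lebesgue. 0 \<le> b x"
    and holder: "holder_const \<beta> g C"
  shows "Lip_star_norm \<beta> q b \<le> ennreal (real CARD('n) powr \<beta> * C)"
  unfolding Lip_star_norm_def
proof (rule SUP_least)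
  fix Q :: "(real ^ 'n) set" assume "Q \<in> cubes"
  then obtain a l where Q: "Q = cube a l" "0 < l" by (auto simp: cubes_eq)
  have "0 \<le> C" using holder by (simp add: holder_const_def)
  have q0: "0 \<le> q x" for x using q[of x] by linarith
  let ?F = "\<lambda>x. (ereal (b x) - enn2ereal (local_maximal Q b x)) * indicator Q x"
  \<comment> \<open>The largest possible oscillation of \<open>g\<close> over the cube, whose points
    are at distance at most n l.\<close>
  define \<delta> where "\<delta> = C * (real CARD('n) * l) powr \<beta>"
  have "0 \<le> \<delta>" using \<open>0 \<le> C\<close> by (simp add: \<delta>_def)
  have osc: "\<bar>g x - g y\<bar> \<le> \<delta>" if "x \<in> cube a l" "y \<in> cube a l" for x y
  proof -
    have "\<bar>g x - g y\<bar> \<le> C * norm (x - y) powr \<beta>"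
      using holder by (simp add: holder_const_def)
    also have "\<dots> \<le> \<delta>"
      unfolding \<delta>_def using \<open>0 \<le> C\<close> \<open>0 < \<beta>\<close>
      by (intro mult_left_mono powr_mono2 norm_diff_le_cube[OF that]) auto
    finally show ?thesis .
  qed
  have "AE x in lebesgue. \<bar>?F x\<bar> \<le> \<bar>ereal \<delta> * indicator Q x\<bar>"
    using bg nonneg
  proof eventually_elim
    case (elim x)
    show ?case
    proof (cases "x \<in> Q")
      case True
      \<comment> \<open>A second exceptional null set, now in \<open>y\<close>, for a fixed good
        point \<open>x\<close>: off both sets \<open>b\<close> may be replaced by \<open>g\<close>
        and |b(y)| by b(y).\<close>
      have "AE y in lebesgue. y \<in> cube a l \<longrightarrow> \<bar>\<bar>b y\<bar> - b x\<bar> \<le> \<delta>"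
        using bg nonneg
      proof eventually_elim
        case (elim y)
        then show ?case using osc[of y x] True Q \<open>b x = g x\<close> by auto
      qed
      then show ?thesis
        using diff_local_maximal_le[OF Q(2), of x a b \<delta>] True Q \<open>0 \<le> \<delta>\<close> elim by simp
    qed simp
  qed
  then have "var_norm q ?F \<le> ennreal \<delta> * var_norm q (indicator Q)"
    using q0 unfolding var_norm_cmult[OF \<open>0 \<le> \<delta>\<close>, symmetric] by (rule var_norm_mono)
  then have "var_norm q ?F / var_norm q (indicator Q) \<le> ennreal \<delta> * var_norm q (indicator Q) / var_norm q (indicator Q)"
    by (rule divide_right_mono_ennreal)
  also have "\<dots> = ennreal \<delta>"
    using var_norm_cube_finite[OF Q(2), of q a, OF q] var_norm_cube_pos[OF Q(2), of q a, OF q]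
    unfolding Q(1) by (intro mult_divide_eq_ennreal) auto
  finally have "1 / ennreal (l powr \<beta>) * (var_norm q ?F / var_norm q (indicator Q)) \<le> 1 / ennreal (l powr \<beta>) * ennreal \<delta>"
    by (rule mult_left_mono) simp
  also have "\<dots> = ennreal (real CARD('n) powr \<beta> * C)"
  proof -
    have "1 / ennreal (l powr \<beta>) = ennreal (1 / l powr \<beta>)"
      using Q(2) divide_ennreal[of 1 "l powr \<beta>"] by simp
    then have "1 / ennreal (l powr \<beta>) * ennreal \<delta> = ennreal (1 / l powr \<beta> * \<delta>)"
      using \<open>0 \<le> \<delta>\<close> by (simp flip: ennreal_mult)
    also have "1 / l powr \<beta> * \<delta> = real CARD('n) powr \<beta> * C"
      using Q(2) by (simp add: \<delta>_def powr_mult)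
    finally show ?thesis .
  qed
  finally show "1 / ennreal (measure lebesgue Q powr (\<beta> / real CARD('n))) * (var_norm q ?F / var_norm q (indicator Q))
      \<le> ennreal (real CARD('n) powr \<beta> * C)"
    using measure_cube_powr[OF Q(2), of a \<beta>] Q(1) by simp
qed

section \<open>The two inclusions and the norm equivalence\<close>

text \<open>The Hoelder representative is continuous, hence integrable on a box around the compact
  set, and integrability transfers across almost everywhere equality.\<close>

lemma Lip_subset_L1_loc:
  assumes "0 < \<beta>"
  shows "Lip \<beta> \<subseteq> L1_loc"
proof
  fix b :: "real ^ 'n::finite \<Rightarrow> real" assume "b \<in> Lip \<beta>"
  then obtain g C where [measurable]: "b \<in> borel_measurable lebesgue"
    and bg: "AE x in lebesgue. b x = g x" and g: "holder_const \<beta> g C"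
    by (auto simp: Lip_def)
  have [measurable]: "g \<in> borel_measurable lebesgue"
    by (rule holder_const_imp_measurable[OF g assms])
  have "set_integrable lebesgue K b" if K_compact: "compact K" for K
  proof -
    obtain u where u: "K \<subseteq> cbox (- u) u"
      using bounded_subset_cbox_symmetric[OF compact_imp_bounded[OF K_compact]] by blast
    have K: "K \<in> sets lebesgue" using K_compact lmeasurable_compact by blast
    have "set_integrable lebesgue (cbox (- u) u) g"
      by (rule absolutely_integrable_continuous[OF holder_const_imp_continuous[OF g assms]])
    then have "set_integrable lebesgue K g"
      using K u by (rule set_integrable_subset)
    moreover have "set_integrable lebesgue K b \<longleftrightarrow> set_integrable lebesgue K g"
      using bg K by (intro set_integrable_cong_AE) auto
    ultimately show ?thesis by simp
  qed
  then show "b \<in> L1_loc" by (simp add: L1_loc_def)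
qed

text \<open>The Hoelder constant is kept explicit and linear in \<open>K\<close>, so that the lower
  norm bound has a constant independent of \<open>b\<close>.\<close>

lemma holder_of_Lip_star:
  fixes q b :: "real ^ 'n::finite \<Rightarrow> real"
  assumes q: "\<And>x. 1 \<le> q x"
    and bdd: "\<And>f. f \<in> var_Lp q \<Longrightarrow>
      var_norm q (\<lambda>x. enn2ereal (HL_maximal f x)) \<le> ennreal C * var_norm q (\<lambda>x. ereal (f x))"
    and "0 < \<beta>" "0 \<le> C" "0 \<le> K"
    and b: "b \<in> L1_loc" and K: "Lip_star_norm \<beta> q b \<le> ennreal K"
  shows "AE x in lebesgue. 0 \<le> b x"
    and "\<exists>g. (AE x in lebesgue. b x = g x) \<and>
      holder_const \<beta> g (4 * 3 ^ CARD('n) * (1 / (1 - 2 powr - \<beta>) + 3 powr \<beta>) * C * K)"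
proof -
  have one_sided: "(LINT x:cube a l|lebesgue. max 0 (avg (\<lambda>x. \<bar>b x\<bar>) a l - b x)) \<le> C * K * l ^ CARD('n) * l powr \<beta>"
    if "0 < l" for a l
    by (rule one_sided_osc_of_Lip_star[where q = q and b = b, OF q bdd \<open>0 \<le> C\<close> \<open>0 \<le> K\<close> that b K])
  have "0 \<le> C * K" using assms by simp
  show "AE x in lebesgue. 0 \<le> b x"
    by (rule AE_nonneg_if_one_sided[OF b \<open>0 < \<beta>\<close> \<open>0 \<le> C * K\<close> one_sided])
  interpret campanato b "2 * (C * K)" \<beta>
    by (rule campanato_if_one_sided[OF b \<open>0 < \<beta>\<close> \<open>0 \<le> C * K\<close> one_sided])
  \<comment> \<open>The constant of \<open>g_holder\<close> at A = 2 C K, where \<open>D\<close> is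
    2 C K / (1 - 2^(-\<beta>)).\<close>
  have "2 * 3 ^ CARD('n) * (D + 3 powr \<beta> * (2 * (C * K)))
      = 4 * 3 ^ CARD('n) * (1 / (1 - 2 powr - \<beta>) + 3 powr \<beta>) * C * K"
    unfolding D_def by (simp add: algebra_simps)
  then show "\<exists>g. (AE x in lebesgue. b x = g x) \<and>
      holder_const \<beta> g (4 * 3 ^ CARD('n) * (1 / (1 - 2 powr - \<beta>) + 3 powr \<beta>) * C * K)"
    using AE_eq_g g_holder by metis
qed

theorem theorem1p5:
  fixes \<beta> :: real
  assumes "0 < \<beta>" and "\<beta> < 1"
  shows "\<forall>q \<in> (exponents_B :: (real ^ 'n::finite \<Rightarrow> real) set).
           Lip_plus \<beta> = Lip_star \<beta> q \<and>
           (\<exists>C\<^sub>1 C\<^sub>2 :: real. 0 < C\<^sub>1 \<and> 0 < C\<^sub>2 \<and>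
              (\<forall>b \<in> Lip_plus \<beta>.
                 ennreal C\<^sub>1 * Lip_norm \<beta> b \<le> Lip_star_norm \<beta> q b \<and>
                 Lip_star_norm \<beta> q b \<le> ennreal C\<^sub>2 * Lip_norm \<beta> b))"
proof
  fix q :: "real ^ 'n \<Rightarrow> real"
  assume "q \<in> exponents_B"
  then obtain C0 where q: "\<And>x. 1 \<le> q x"
    and C0: "\<And>f. f \<in> var_Lp q \<Longrightarrow>
      var_norm q (\<lambda>x. enn2ereal (HL_maximal f x)) \<le> ennreal C0 * var_norm q (\<lambda>x. ereal (f x))"
    by (auto simp: exponents_B_def exponents_P_def)
  \<comment> \<open>The bound from \<open>exponents_B\<close> may be any real; raising it to at
    least 1 ensures that \<open>M\<close>, and so 1 / M, is positive.\<close>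
  define C where "C = max C0 1"
  have bdd: "var_norm q (\<lambda>x. enn2ereal (HL_maximal f x)) \<le> ennreal C * var_norm q (\<lambda>x. ereal (f x))"
    if "f \<in> var_Lp q" for f
    using C0[OF that] by (rule order_trans) (auto simp: C_def intro!: mult_right_mono ennreal_leI)
  have "0 < C" by (simp add: C_def)
  define M where "M = 4 * 3 ^ CARD('n) * (1 / (1 - 2 powr - \<beta>) + 3 powr \<beta>) * C"
  have "2 powr - \<beta> < 1"
    using assms powr_less_mono[of "- \<beta>" 0 2] by simp
  then have "0 < M"
    using \<open>0 < C\<close> by (simp add: M_def add_pos_pos)
  define P where "P = real CARD('n) powr \<beta>"
  have "0 < P" by (simp add: P_def)
  have L1: "b \<in> L1_loc" if "b \<in> Lip_plus \<beta>" for b :: "real ^ 'n \<Rightarrow> real"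
    using that Lip_subset_L1_loc[OF assms(1)] by (auto simp: Lip_plus_def)
  have upper: "Lip_star_norm \<beta> q b \<le> ennreal (P * K)"
    if "b \<in> Lip_plus \<beta>" "AE x in lebesgue. b x = g x" "holder_const \<beta> g K" for b g K
    unfolding P_def using that by (intro Lip_star_norm_le_holder_const assms q) (auto simp: Lip_plus_def)
  have "Lip_plus \<beta> = Lip_star \<beta> q"
  proof (intro set_eqI iffI)
    fix b :: "real ^ 'n \<Rightarrow> real" assume b: "b \<in> Lip_plus \<beta>"
    then obtain g K where "AE x in lebesgue. b x = g x" "holder_const \<beta> g K"
      by (auto simp: Lip_plus_def Lip_def)
    then have "Lip_star_norm \<beta> q b < \<infinity>"
      using upper[OF b] by (metis ennreal_less_top infinity_ennreal_def le_less_trans)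
    then show "b \<in> Lip_star \<beta> q"
      using L1[OF b] by (simp add: Lip_star_def)
  next
    fix b :: "real ^ 'n \<Rightarrow> real" assume "b \<in> Lip_star \<beta> q"
    then have b: "b \<in> L1_loc" "Lip_star_norm \<beta> q b < top" by (auto simp: Lip_star_def)
    then obtain K where K: "0 \<le> K" "Lip_star_norm \<beta> q b \<le> ennreal K"
      by (cases "Lip_star_norm \<beta> q b" rule: ennreal_cases) auto
    have "b \<in> borel_measurable lebesgue" using b by (simp add: L1_loc_def)
    then show "b \<in> Lip_plus \<beta>"
      using holder_of_Lip_star[where q = q and b = b, OF q bdd assms(1) less_imp_le[OF \<open>0 < C\<close>] K(1) b(1) K(2)]
      by (auto simp: Lip_plus_def Lip_def)
  qed
  moreover have "ennreal (1 / M) * Lip_norm \<beta> b \<le> Lip_star_norm \<beta> q b" if b: "b \<in> Lip_plus \<beta>" for b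
  proof (cases "Lip_star_norm \<beta> q b" rule: ennreal_cases)
    \<comment> \<open>The finite value of the starred norm itself serves as \<open>K\<close>; an
      infinite value makes the inequality trivial.\<close>
    case (real K)
    then obtain g where "AE x in lebesgue. b x = g x" "holder_const \<beta> g (M * K)"
      using holder_of_Lip_star(2)[where q = q and b = b and K = K, OF q bdd assms(1) less_imp_le[OF \<open>0 < C\<close>] real(1) L1[OF b]]
      by (auto simp: M_def)
    then have "Lip_norm \<beta> b \<le> ennreal (M * K)"
      unfolding Lip_norm_def by (intro INF_lower) auto
    then have "ennreal (1 / M) * Lip_norm \<beta> b \<le> ennreal (1 / M) * ennreal (M * K)"
      by (rule mult_left_mono) simp
    also have "\<dots> = Lip_star_norm \<beta> q b"
      using \<open>0 < M\<close> real by (simp flip: ennreal_mult)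
    finally show ?thesis .
  qed simp
  moreover have "Lip_star_norm \<beta> q b \<le> ennreal P * Lip_norm \<beta> b" if "b \<in> Lip_plus \<beta>" for b
  proof -
    \<comment> \<open>Dividing by \<open>P\<close> first leaves the bare infimum on the right, so
      the bound can be checked for each admissible constant separately.\<close>
    have "ennreal (1 / P) * Lip_star_norm \<beta> q b \<le> Lip_norm \<beta> b"
      unfolding Lip_norm_def
    proof (rule INF_greatest)
      fix K assume "K \<in> {K. \<exists>g. (AE x in lebesgue. b x = g x) \<and> holder_const \<beta> g K}"
      then have "Lip_star_norm \<beta> q b \<le> ennreal (P * K)" "0 \<le> K"
        using upper[OF that] by (auto simp: holder_const_def)
      then have "ennreal (1 / P) * Lip_star_norm \<beta> q b \<le> ennreal (1 / P) * ennreal (P * K)"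
        by (intro mult_left_mono) auto
      also have "\<dots> = ennreal K"
        using \<open>0 < P\<close> \<open>0 \<le> K\<close> by (simp flip: ennreal_mult)
      finally show "ennreal (1 / P) * Lip_star_norm \<beta> q b \<le> ennreal K" .
    qed
    then have "ennreal P * (ennreal (1 / P) * Lip_star_norm \<beta> q b) \<le> ennreal P * Lip_norm \<beta> b"
      by (rule mult_left_mono) simp
    then show ?thesis
      using \<open>0 < P\<close> by (simp flip: mult.assoc ennreal_mult')
  qed
  ultimately show "Lip_plus \<beta> = Lip_star \<beta> q \<and>
      (\<exists>C\<^sub>1 C\<^sub>2 :: real. 0 < C\<^sub>1 \<and> 0 < C\<^sub>2 \<and>
        (\<forall>b \<in> Lip_plus \<beta>. ennreal C\<^sub>1 * Lip_norm \<beta> b \<le> Lip_star_norm \<beta> q b \<and>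
          Lip_star_norm \<beta> q b \<le> ennreal C\<^sub>2 * Lip_norm \<beta> b))"
    using \<open>0 < M\<close> \<open>0 < P\<close> by (intro conjI exI[of _ "1 / M"] exI[of _ P]) auto
qed

end
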